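(* Let $b,c,\beta,\mu,\nu,g$ and the operator $L$ with domain $\mathcal D(L)$ be as in the context, and let $V_{\log}(x)=\log(1+x)$ for $x\ge0$. Suppose that $$\int_1^\infty\log(1+z)\,\mu(dz)+\int_1^\infty\log(1+z)\,\nu(dz)<\infty .$$ Then $V_{\log}\in\mathcal D(L)$, and there exist constants $C_0,C_1>0$ such that $LV_{\log}(x)\le C_0-C_1V_{\log}(x)$ for all $x\ge0$ if and only if $$\liminf_{x\to\infty}\bigg\{\frac{g(x)}{x\log x}-\frac{x}{\log x}\int_1^\infty\log\Big(1+\frac{z}{1+x}\Big)\mu(dz)\bigg\}>0 .$$
   Context: $b\in\mathbb R$, $c\ge0$, $\beta\ge0$ are constants; $\mu$ and $\nu$ are measures on $(0,\infty)$ with $\int_0^\infty(1\wedge z^2)\mu(dz)<\infty$ and $\int_0^\infty(1\wedge z)\nu(dz)<\infty$; $g$ is a nondecreasing continuous function on $[0,\infty)$ with $g(0)=0$. The convention $\int_1^\infty=\int_{(1,\infty)}$ is used. For $f\in C^2(\mathbb R_+)$ and $x\ge 0$, with $\Delta_zf(x)=f(x+z)-f(x)$, $$Lf(x)=cxf''(x)+x\int_0^\infty[\Delta_zf(x)-zf'(x)\mathbf 1_{\{z\le1\}}]\mu(dz)+[\beta-bx-g(x)]f'(x)+\int_0^\infty\Delta_zf(x)\nu(dz).$$ $\mathcal D(L)$ is the linear space of $f\in C^2(\mathbb R_+)$ such that the two integrals converge and define continuous functions of $x\in\mathbb R_+$. *)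

theory Defs
  imports "HOL-Analysis.Analysis"
begin

text \<open>
  Functions on \<open>\<real>\<^sub>+ = [0,\<infinity>)\<close> are represented by functions of type \<^typ>\<open>real \<Rightarrow> real\<close> of which only
  the values on \<^term>\<open>{0::real..}\<close> matter. Accordingly all derivatives are taken within
  \<^term>\<open>{0::real..}\<close>, so that they are one-sided at \<open>0\<close>.
\<close>

definition deriv_Rp :: "(real \<Rightarrow> real) \<Rightarrow> real \<Rightarrow> real" where
  "deriv_Rp f x = vector_derivative f (at x within {0..})"

definition C2_Rp :: "(real \<Rightarrow> real) set" where
  "C2_Rp = {f. f differentiable_on {0..} \<and> deriv_Rp f differentiable_on {0..} \<and>
               continuous_on {0..} (deriv_Rp (deriv_Rp f))}"

definition diff_op :: "real \<Rightarrow> (real \<Rightarrow> real) \<Rightarrow> real \<Rightarrow> real"  (\<open>\<Delta>\<^bsub>_\<^esub>\<close>) where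
  "\<Delta>\<^bsub>z\<^esub> f x = f (x + z) - f x"

definition mu_integrand :: "(real \<Rightarrow> real) \<Rightarrow> real \<Rightarrow> real \<Rightarrow> real" where
  "mu_integrand f x z = \<Delta>\<^bsub>z\<^esub> f x - z * deriv_Rp f x * indicator {..1} z"

text \<open>The measures \<open>\<mu>\<close> and \<open>\<nu>\<close> will have \<^term>\<open>{0::real<..}\<close> as their whole space, so an integral
  without a domain is the integral over \<open>(0,\<infinity>)\<close>.\<close>

definition gen_L ::
  "real \<Rightarrow> real \<Rightarrow> real \<Rightarrow> (real \<Rightarrow> real) \<Rightarrow> real measure \<Rightarrow> real measure
     \<Rightarrow> (real \<Rightarrow> real) \<Rightarrow> real \<Rightarrow> real" where
  "gen_L b c \<beta> g \<mu> \<nu> f x =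
     c * x * deriv_Rp (deriv_Rp f) x
     + x * (LINT z|\<mu>. mu_integrand f x z)
     + (\<beta> - b * x - g x) * deriv_Rp f x
     + (LINT z|\<nu>. \<Delta>\<^bsub>z\<^esub> f x)"

definition dom_L :: "real measure \<Rightarrow> real measure \<Rightarrow> (real \<Rightarrow> real) set" where
  "dom_L \<mu> \<nu> = {f \<in> C2_Rp.
     (\<forall>x\<ge>0. integrable \<mu> (mu_integrand f x)) \<and>
     continuous_on {0..} (\<lambda>x. LINT z|\<mu>. mu_integrand f x z) \<and>
     (\<forall>x\<ge>0. integrable \<nu> (\<lambda>z. \<Delta>\<^bsub>z\<^esub> f x)) \<and>
     continuous_on {0..} (\<lambda>x. LINT z|\<nu>. \<Delta>\<^bsub>z\<^esub> f x)}"

definition V_log :: "real \<Rightarrow> real" where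
  "V_log x = ln (1 + x)"

end

theory Submission
  imports Defs
begin

text \<open>
  Write \<open>M(x) = \<integral>\<^bsub>(1,\<infinity>)\<^esub> ln (1 + z/(1+x)) \<mu>(dz)\<close> for the contribution of the large jumps. Since
  \<open>V_log'(x) = 1/(1+x)\<close> and a jump of size \<open>z\<close> raises \<open>V_log\<close> by \<open>ln (1 + z/(1+x))\<close>, all parts of
  \<open>L V_log\<close> except two are bounded on \<open>[0,\<infinity>)\<close>: the diffusion term is of order \<open>x/(1+x)\<^sup>2\<close>, the
  compensated small jumps are second-order Taylor remainders and contribute at most
  \<open>x/(1+x)\<^sup>2 \<integral> min 1 z\<^sup>2 \<mu>(dz)\<close>, the linear drift is divided by \<open>1+x\<close>, and the jumps
  governed by \<open>\<nu>\<close> raise \<open>V_log\<close> most at \<open>x = 0\<close>, by \<open>ln (1 + z)\<close>, which is \<open>\<nu>\<close>-integrable. What remains is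
  \<open>L V_log(x) = x M(x) - g(x)/(1+x) + O(1)\<close>.

  The quantity in the lower limit is \<open>H(x) = (g(x)/x - x M(x)) / ln x\<close>, so
  \<open>- H(x) ln x\<close> differs from this main part only in that \<open>g\<close> is divided by \<open>x\<close> rather than by \<open>1+x\<close>. As \<open>g\<close> may grow arbitrarily fast, the difference
  \<open>g(x)/(x(1+x))\<close> need not be bounded. It is harmless all the same. From the drift condition to
  the lower limit it has the right sign, because \<open>g \<ge> 0\<close>. In the other direction the identity
  \<open>x M(x) - g(x)/(1+x) = x/(1+x) M(x) - x/(1+x) (g(x)/x - x M(x))\<close> replaces it by a term that is at
  most \<open>M(0)\<close>, and the price is the factor \<open>x/(1+x) \<ge> 1/2\<close> in front of \<open>H(x) ln x\<close>. This argument is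
  \<open>log_drift_iff_Liminf\<close>.

  That \<open>V_log\<close> lies in the domain follows from dominated convergence: uniformly in \<open>x\<close>, the two integrands
  are dominated by \<open>min 1 z\<^sup>2\<close> and \<open>min 1 z\<close>, each increased by \<open>ln (1 + z)\<close> on \<open>z > 1\<close>.
\<close>

section \<open>Derivatives of the logarithm on the half-line\<close>

text \<open>A derivative within \<open>[0,\<infinity>)\<close> is unique because no point of the half-line, \<open>0\<close> included, is isolated
  in it.\<close>

lemma deriv_Rp_eqI:
  assumes "(f has_real_derivative d) (at x within {0..})" "x \<ge> 0"
  shows "deriv_Rp f x = d"
proof -
  have "at x within {0..} \<noteq> bot"
  proof (cases "x = 0")
    case True
    then show ?thesis
      using trivial_limit_at_right_real[of x] by (simp add: at_within_Ici_at_right)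
  next
    case False
    then have "x \<in> interior {0..}"
      using assms(2) by (simp add: interior_real_atLeast)
    then show ?thesis
      by (simp only: at_within_interior at_neq_bot not_False_eq_True)
  qed
  then show ?thesis
    unfolding deriv_Rp_def
    using assms(1) by (intro vector_derivative_within)
      (simp_all only: has_real_derivative_iff_has_vector_derivative not_False_eq_True)
qed

lemma V_log_has_derivative:
  assumes "x \<ge> 0"
  shows "(V_log has_real_derivative 1 / (1 + x)) (at x within {0..})"
proof -
  have "((\<lambda>x. ln (1 + x)) has_real_derivative 1 / (1 + x)) (at x within {0..})"
    by (rule derivative_eq_intros refl | use assms in simp)+
  then show ?thesis
    by (simp add: V_log_def[abs_def])
qed

lemma deriv_Rp_V_log: "x \<ge> 0 \<Longrightarrow> deriv_Rp V_log x = 1 / (1 + x)"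
  by (rule deriv_Rp_eqI[OF V_log_has_derivative])

lemma deriv_V_log_has_derivative:
  assumes "x \<ge> 0"
  shows "(deriv_Rp V_log has_real_derivative - (1 / (1 + x)\<^sup>2)) (at x within {0..})"
proof (rule has_field_derivative_transform_within[where d = 1 and f = "\<lambda>x. 1 / (1 + x)"])
  show "((\<lambda>x. 1 / (1 + x)) has_real_derivative - (1 / (1 + x)\<^sup>2)) (at x within {0..})"
    by (rule derivative_eq_intros refl | use assms in \<open>simp add: power2_eq_square\<close>)+
qed (use assms in \<open>auto simp: deriv_Rp_V_log\<close>)

lemma deriv2_Rp_V_log: "x \<ge> 0 \<Longrightarrow> deriv_Rp (deriv_Rp V_log) x = - (1 / (1 + x)\<^sup>2)"
  by (rule deriv_Rp_eqI[OF deriv_V_log_has_derivative])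

lemma V_log_in_C2_Rp: "V_log \<in> C2_Rp"
proof -
  have "continuous_on {0..} (\<lambda>x::real. - (1 / (1 + x)\<^sup>2))"
    by (intro continuous_intros) auto
  then have "continuous_on {0..} (deriv_Rp (deriv_Rp V_log))"
    by (rule continuous_on_eq) (simp add: deriv2_Rp_V_log)
  moreover have "V_log differentiable_on {0..}" "deriv_Rp V_log differentiable_on {0..}"
    unfolding differentiable_on_def real_differentiable_def
    using V_log_has_derivative deriv_V_log_has_derivative by auto
  ultimately show ?thesis
    unfolding C2_Rp_def by blast
qed

section \<open>Bounds for the integrands\<close>

lemma diff_op_V_log:
  assumes "x \<ge> 0" "z > 0"
  shows "\<Delta>\<^bsub>z\<^esub> V_log x = ln (1 + z / (1 + x))"
proof -
  have "1 + z / (1 + x) = (1 + (x + z)) / (1 + x)"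
    using assms by (simp add: field_simps)
  then show ?thesis
    using assms by (simp add: diff_op_def V_log_def ln_div)
qed

lemma ln_jump_nonneg:
  fixes x z :: real
  assumes "x \<ge> 0" "z > 0"
  shows "0 \<le> ln (1 + z / (1 + x))"
  using assms by (intro ln_ge_zero) simp

lemma ln_jump_le:
  fixes x z :: real
  assumes "x \<ge> 0" "z > 0"
  shows "ln (1 + z / (1 + x)) \<le> ln (1 + z)"
proof -
  have "z / (1 + x) \<le> z / 1"
    using assms by (intro divide_left_mono) auto
  moreover have "0 < 1 + z / (1 + x)"
    using assms by (simp add: add_pos_pos)
  ultimately show ?thesis
    by (intro ln_mono) auto
qed

lemma diff_op_V_log_bounds:
  assumes "x \<ge> 0" "z > 0"
  shows "0 \<le> \<Delta>\<^bsub>z\<^esub> V_log x"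
    and "\<Delta>\<^bsub>z\<^esub> V_log x \<le> min 1 z + indicator {1<..} z * ln (1 + z)"
proof -
  show "0 \<le> \<Delta>\<^bsub>z\<^esub> V_log x"
    using assms by (simp only: diff_op_V_log ln_jump_nonneg)
  have "ln (1 + z / (1 + x)) \<le> ln (1 + z)" "ln (1 + z) \<le> z"
    using assms ln_jump_le ln_add_one_self_le_self[of z] by auto
  then show "\<Delta>\<^bsub>z\<^esub> V_log x \<le> min 1 z + indicator {1<..} z * ln (1 + z)"
    using assms by (auto simp: diff_op_V_log indicator_def min_def)
qed

text \<open>With \<open>u = z/(1+x)\<close>, the jumps \<open>z \<le> 1\<close> leave the remainder \<open>ln (1 + u) - u\<close>, which is at most
  \<open>u\<^sup>2\<close>; for \<open>z > 1\<close> the difference vanishes. The decay in \<open>x\<close> is what compensates the factor \<open>x\<close> in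
  front of the \<open>\<mu>\<close>-integral of the generator.\<close>

lemma mu_integrand_V_log_small_jumps:
  assumes "x \<ge> 0" "z > 0"
  shows "\<bar>mu_integrand V_log x z - indicator {1<..} z * ln (1 + z / (1 + x))\<bar>
           \<le> min 1 (z\<^sup>2) / (1 + x)\<^sup>2"
proof (cases "z \<le> 1")
  case True
  let ?u = "z / (1 + x)"
  have "0 \<le> ?u" "?u \<le> 1"
    using assms True by (auto simp: divide_simps)
  then have "\<bar>ln (1 + ?u) - ?u\<bar> \<le> ?u\<^sup>2"
    by (rule abs_ln_one_plus_x_minus_x_bound_nonneg)
  moreover have "z\<^sup>2 \<le> 1"
    using True assms by (simp add: power_le_one)
  ultimately show ?thesis
    using assms True
    by (simp add: mu_integrand_def diff_op_V_log deriv_Rp_V_log power_divide min_def)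
next
  case False
  then show ?thesis
    using assms by (simp add: mu_integrand_def diff_op_V_log)
qed

lemma mu_integrand_V_log_bound:
  assumes "x \<ge> 0" "z > 0"
  shows "\<bar>mu_integrand V_log x z\<bar> \<le> min 1 (z\<^sup>2) + indicator {1<..} z * ln (1 + z)"
proof -
  have "(1 + x)\<^sup>2 \<ge> 1"
    using assms by (intro one_le_power) simp
  then have "min 1 (z\<^sup>2) / (1 + x)\<^sup>2 \<le> min 1 (z\<^sup>2) / 1"
    by (intro divide_left_mono) auto
  moreover have "indicator {1<..} z * ln (1 + z / (1 + x)) \<le> indicator {1<..} z * ln (1 + z)"
    using ln_jump_le[OF assms] by (intro mult_left_mono) auto
  moreover have "0 \<le> indicator {1<..} z * ln (1 + z / (1 + x))"
    using ln_jump_nonneg[OF assms] by simp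
  ultimately show ?thesis
    using mu_integrand_V_log_small_jumps[OF assms] by linarith
qed

section \<open>Integrals depending on a parameter\<close>

lemma borel_measurable_half_line:
  assumes "sets M = sets (restrict_space borel {0::real<..})" "f \<in> borel_measurable borel"
  shows "f \<in> borel_measurable M"
  using measurable_restrict_space1[OF assms(2)] measurable_cong_sets[OF assms(1) refl] by blast

lemma space_half_line:
  assumes "sets M = sets (restrict_space borel {0::real<..})"
  shows "space M = {0<..}"
  using sets_eq_imp_space_eq[OF assms] by (simp add: space_restrict_space)

lemma integrable_nonneg_half_line:
  fixes f :: "real \<Rightarrow> real"
  assumes M: "sets M = sets (restrict_space borel {0::real<..})"
    and f: "f \<in> borel_measurable borel" "\<And>z. z > 0 \<Longrightarrow> f z \<ge> 0"
    and fin: "(\<integral>\<^sup>+z. ennreal (f z) \<partial>M) < \<infinity>"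
  shows "integrable M f"
proof (rule integrableI_bounded)
  have "(\<integral>\<^sup>+z. ennreal (norm (f z)) \<partial>M) = (\<integral>\<^sup>+z. ennreal (f z) \<partial>M)"
    by (intro nn_integral_cong) (simp add: space_half_line[OF M] f)
  then show "(\<integral>\<^sup>+z. ennreal (norm (f z)) \<partial>M) < \<infinity>"
    using fin by simp
qed (rule borel_measurable_half_line[OF M f(1)])

lemma continuous_on_integral_dominated:
  fixes f :: "'a::metric_space \<Rightarrow> 'b \<Rightarrow> real"
  assumes meas: "\<And>x. x \<in> S \<Longrightarrow> f x \<in> borel_measurable M"
    and cont: "\<And>z. z \<in> space M \<Longrightarrow> continuous_on S (\<lambda>x. f x z)"
    and bound: "\<And>x z. x \<in> S \<Longrightarrow> z \<in> space M \<Longrightarrow> \<bar>f x z\<bar> \<le> w z"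
    and w: "integrable M w"
  shows "continuous_on S (\<lambda>x. LINT z|M. f x z)"
  unfolding continuous_on_sequentially comp_def
proof (intro ballI allI impI, elim conjE)
  fix a u assume a: "a \<in> S" and u: "\<forall>n. u n \<in> S" and lim: "u \<longlonglongrightarrow> a"
  show "(\<lambda>n. LINT z|M. f (u n) z) \<longlonglongrightarrow> (LINT z|M. f a z)"
  proof (rule integral_dominated_convergence[OF _ _ w])
    have "(\<lambda>n. f (u n) z) \<longlonglongrightarrow> f a z" if "z \<in> space M" for z
      using cont[OF that] a u lim unfolding continuous_on_sequentially comp_def by blast
    then show "AE z in M. (\<lambda>n. f (u n) z) \<longlonglongrightarrow> f a z"
      by simp
  qed (use meas bound a u in auto)
qed

section \<open>Logarithmic drift and the lower limit\<close>

text \<open>Here \<open>M\<close> stands for the large-jump integral and \<open>L\<close> for the generator at \<open>V_log\<close>.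
  Boundedness of \<open>M\<close> is what allows \<open>g(x)/x\<close> and \<open>g(x)/(1+x)\<close> to be exchanged without an upper bound on \<open>g\<close>.\<close>

lemma log_drift_iff_Liminf:
  fixes g M L :: "real \<Rightarrow> real"
  assumes g: "\<And>x. x \<ge> 0 \<Longrightarrow> 0 \<le> g x"
    and M: "\<And>x. x \<ge> 0 \<Longrightarrow> 0 \<le> M x" "\<And>x. x \<ge> 0 \<Longrightarrow> M x \<le> m"
    and L: "\<And>x. x \<ge> 0 \<Longrightarrow> \<bar>L x - (x * M x - g x / (1 + x))\<bar> \<le> K"
  shows "(\<exists>C\<^sub>0 C\<^sub>1. C\<^sub>0 > 0 \<and> C\<^sub>1 > 0 \<and> (\<forall>x\<ge>0. L x \<le> C\<^sub>0 - C\<^sub>1 * V_log x)) \<longleftrightarrow>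
    Liminf at_top (\<lambda>x. ereal (g x / (x * ln x) - x / ln x * M x)) > 0"
    (is "?drift \<longleftrightarrow> Liminf at_top (\<lambda>x. ereal (?H x)) > 0")
proof
  assume ?drift
  then obtain C\<^sub>0 C\<^sub>1 where C: "C\<^sub>0 > 0" "C\<^sub>1 > 0"
    and LC: "\<And>x. x \<ge> 0 \<Longrightarrow> L x \<le> C\<^sub>0 - C\<^sub>1 * V_log x" by blast
  \<comment> \<open>Beyond this point half of \<open>C\<^sub>1 ln x\<close> absorbs the additive constants \<open>C\<^sub>0 + K\<close>.\<close>
  have "eventually (\<lambda>x::real. x > 1 \<and> ln x \<ge> 2 * (C\<^sub>0 + K) / C\<^sub>1) at_top"
    using eventually_gt_at_top[of 1] filterlim_at_top[THEN iffD1, OF ln_at_top]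
    by (auto intro: eventually_conj)
  then have "eventually (\<lambda>x. ereal (C\<^sub>1 / 2) \<le> ereal (?H x)) at_top"
  proof eventually_elim
    case (elim x)
    then have x: "x > 1" and l: "C\<^sub>0 + K \<le> C\<^sub>1 * ln x / 2"
      using C by (auto simp: field_simps)
    have "ln x > 0" using x by simp
    have "g x / (1 + x) \<le> g x / x"
      using g[of x] x by (intro divide_left_mono) auto
    moreover have "C\<^sub>1 * ln x \<le> C\<^sub>1 * V_log x"
      using x C by (auto simp: V_log_def)
    ultimately have "C\<^sub>1 / 2 * ln x \<le> g x / x - x * M x"
      using L[of x] LC[of x] x l by linarith
    then have "C\<^sub>1 / 2 \<le> (g x / x - x * M x) / ln x"
      using \<open>ln x > 0\<close> by (simp add: pos_le_divide_eq)
    also have "\<dots> = ?H x"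
      by (simp add: diff_divide_distrib)
    finally show ?case by simp
  qed
  then have "ereal (C\<^sub>1 / 2) \<le> Liminf at_top (\<lambda>x. ereal (?H x))"
    by (rule Liminf_bounded)
  with C show "Liminf at_top (\<lambda>x. ereal (?H x)) > 0"
    by (metis ereal_less(2) half_gt_zero less_le_trans)
next
  assume "Liminf at_top (\<lambda>x. ereal (?H x)) > 0"
  then obtain \<delta> where \<delta>: "0 < ereal \<delta>" "ereal \<delta> < Liminf at_top (\<lambda>x. ereal (?H x))"
    using ereal_dense2 by blast
  have "eventually (\<lambda>x. ereal \<delta> < ereal (?H x)) at_top"
    using less_LiminfD[OF \<delta>(2)] .
  then have "eventually (\<lambda>x. \<delta> < ?H x) at_top"
    by simp
  then obtain r where r: "\<And>x. x \<ge> r \<Longrightarrow> \<delta> < ?H x"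
    unfolding eventually_at_top_linorder by blast
  \<comment> \<open>For \<open>x \<ge> 2\<close>, \<open>ln x > 0\<close> and \<open>x/(1+x) \<ge> 1/2\<close>, and \<open>1 + x \<le> x\<^sup>2\<close> makes \<open>V_log x \<le> 2 ln x\<close>; the two
    factors \<open>1/2\<close> turn \<open>\<delta>\<close> into \<open>\<delta>/4\<close>. Below \<open>R\<close>, \<open>x M(x) - g(x)/(1+x) \<le> R m\<close>.\<close>
  define R where "R = max r 2"
  have "R \<ge> 2" by (simp add: R_def)
  have "m \<ge> 0" "K \<ge> 0"
    using M[of 0] L[of 0] by auto
  have "\<delta> > 0" using \<delta> by simp
  have "ln (1 + R) \<ge> 0" using \<open>R \<ge> 2\<close> by simp
  define C\<^sub>0 where "C\<^sub>0 = 1 + K + R * m + m + \<delta> / 4 * ln (1 + R)"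
  have "L x \<le> C\<^sub>0 - \<delta> / 4 * V_log x" if "x \<ge> 0" for x
  proof (cases "x \<le> R")
    case True
    have "x * M x \<le> R * m"
      using that True M[of x] \<open>R \<ge> 2\<close> by (intro mult_mono) auto
    moreover have "0 \<le> g x / (1 + x)"
      using g that by simp
    moreover have "V_log x \<le> ln (1 + R)"
      using that True by (simp add: V_log_def)
    then have "\<delta> / 4 * V_log x \<le> \<delta> / 4 * ln (1 + R)"
      using \<open>\<delta> > 0\<close> by (intro mult_left_mono) auto
    ultimately show ?thesis
      using L[OF that] \<open>m \<ge> 0\<close> unfolding C\<^sub>0_def by linarith
  next
    case False
    then have x: "x \<ge> 2" "x \<ge> r" by (auto simp: R_def)
    then have "ln x > 0" by simp
    have "?H x = (g x / x - x * M x) / ln x"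
      by (simp add: diff_divide_distrib)
    then have H: "\<delta> * ln x < g x / x - x * M x"
      using r[OF x(2)] \<open>ln x > 0\<close> by (simp add: pos_less_divide_eq)
    have "x * M x - g x / (1 + x) = x / (1 + x) * M x - x / (1 + x) * (g x / x - x * M x)"
    proof -
      define q where "q = x / (1 + x)"
      have "q * (g x / x) = g x / (1 + x)" "q * ((1 + x) * M x) = x * M x"
        using x by (simp_all add: q_def)
      moreover have "q * M x - q * (g x / x - x * M x) = q * ((1 + x) * M x) - q * (g x / x)"
        by (simp add: algebra_simps)
      ultimately show ?thesis
        by (simp add: q_def)
    qed
    moreover have "x / (1 + x) * M x \<le> 1 * m"
      using M[of x] x by (intro mult_mono) auto
    moreover have "1 / 2 * (\<delta> * ln x) \<le> x / (1 + x) * (g x / x - x * M x)"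
      using H x \<open>\<delta> > 0\<close> \<open>ln x > 0\<close> by (intro mult_mono) (auto simp: field_simps)
    moreover have "V_log x \<le> 2 * ln x"
    proof -
      have "2 * x \<le> x * x"
        using x by (intro mult_right_mono) auto
      then have "1 + x \<le> x ^ 2"
        unfolding power2_eq_square using x by linarith
      then have "V_log x \<le> ln (x ^ 2)"
        unfolding V_log_def using x by (intro ln_mono) auto
      then show ?thesis
        using x by (simp add: ln_realpow)
    qed
    then have "\<delta> / 4 * V_log x \<le> 1 / 2 * (\<delta> * ln x)"
      using \<open>\<delta> > 0\<close> by simp
    moreover have "0 \<le> R * m" "0 \<le> \<delta> / 4 * ln (1 + R)"
      using \<open>R \<ge> 2\<close> \<open>m \<ge> 0\<close> \<open>\<delta> > 0\<close> \<open>ln (1 + R) \<ge> 0\<close> by auto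
    ultimately show ?thesis
      using L[OF that] unfolding C\<^sub>0_def by linarith
  qed
  moreover have "C\<^sub>0 > 0"
    using \<open>R \<ge> 2\<close> \<open>m \<ge> 0\<close> \<open>K \<ge> 0\<close> \<open>\<delta> > 0\<close> \<open>ln (1 + R) \<ge> 0\<close>
    unfolding C\<^sub>0_def by (intro add_pos_nonneg) auto
  ultimately show ?drift
    using \<open>\<delta> > 0\<close> by (intro exI[of _ C\<^sub>0] exI[of _ "\<delta> / 4"]) auto
qed

section \<open>The generator applied to the logarithm\<close>

theorem proposition1p3:
  fixes b c \<beta> :: real and \<mu> \<nu> :: "real measure" and g :: "real \<Rightarrow> real"
  assumes "c \<ge> 0" and "\<beta> \<ge> 0"
    and "sets \<mu> = sets (restrict_space borel {0<..})"
    and "sets \<nu> = sets (restrict_space borel {0<..})"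
    and "(\<integral>\<^sup>+z. ennreal (min 1 (z\<^sup>2)) \<partial>\<mu>) < \<infinity>"
    and "(\<integral>\<^sup>+z. ennreal (min 1 z) \<partial>\<nu>) < \<infinity>"
    and "mono_on {0..} g" and "continuous_on {0..} g" and "g 0 = 0"
    and "(\<integral>\<^sup>+z\<in>{1<..}. ennreal (ln (1 + z)) \<partial>\<mu>) + (\<integral>\<^sup>+z\<in>{1<..}. ennreal (ln (1 + z)) \<partial>\<nu>) < \<infinity>"
  shows "V_log \<in> dom_L \<mu> \<nu> \<and>
    ((\<exists>C\<^sub>0 C\<^sub>1. C\<^sub>0 > 0 \<and> C\<^sub>1 > 0 \<and>
        (\<forall>x\<ge>0. gen_L b c \<beta> g \<mu> \<nu> V_log x \<le> C\<^sub>0 - C\<^sub>1 * V_log x)) \<longleftrightarrow>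
     Liminf at_top (\<lambda>x::real. ereal (g x / (x * ln x)
        - x / ln x * (LINT z:{1<..}|\<mu>. ln (1 + z / (1 + x))))) > 0)"
proof -
  note sets_mu = assms(3) and sets_nu = assms(4)
  note space_mu = space_half_line[OF sets_mu] and space_nu = space_half_line[OF sets_nu]
  have log_integrable: "integrable N (\<lambda>z. indicator {1<..} z * ln (1 + z))"
    if "sets N = sets (restrict_space borel {0<..})"
      "(\<integral>\<^sup>+z\<in>{1<..}. ennreal (ln (1 + z)) \<partial>N) < \<infinity>" for N :: "real measure"
  proof (rule integrable_nonneg_half_line[OF that(1)])
    have "(\<integral>\<^sup>+z. ennreal (indicator {1<..} z * ln (1 + z)) \<partial>N)
            = (\<integral>\<^sup>+z\<in>{1<..}. ennreal (ln (1 + z)) \<partial>N)"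
      by (intro nn_integral_cong) (simp add: indicator_def)
    then show "(\<integral>\<^sup>+z. ennreal (indicator {1<..} z * ln (1 + z)) \<partial>N) < \<infinity>"
      using that(2) by simp
  qed auto
  have log_mu: "integrable \<mu> (\<lambda>z. indicator {1<..} z * ln (1 + z))"
    and log_nu: "integrable \<nu> (\<lambda>z. indicator {1<..} z * ln (1 + z))"
    using assms(10) log_integrable[OF sets_mu] log_integrable[OF sets_nu] by auto
  have small_mu: "integrable \<mu> (\<lambda>z. min 1 (z\<^sup>2))"
    by (rule integrable_nonneg_half_line[OF sets_mu _ _ assms(5)]) auto
  have small_nu: "integrable \<nu> (\<lambda>z. min 1 z)"
    by (rule integrable_nonneg_half_line[OF sets_nu _ _ assms(6)]) auto
  define w\<mu> :: "real \<Rightarrow> real" where "w\<mu> z = min 1 (z\<^sup>2) + indicator {1<..} z * ln (1 + z)" for z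
  define w\<nu> :: "real \<Rightarrow> real" where "w\<nu> z = min 1 z + indicator {1<..} z * ln (1 + z)" for z
  have int_w: "integrable \<mu> w\<mu>" "integrable \<nu> w\<nu>"
    unfolding w\<mu>_def w\<nu>_def using log_mu log_nu small_mu small_nu by auto
  have meas_mu: "mu_integrand V_log x \<in> borel_measurable \<mu>" for x
    by (rule borel_measurable_half_line[OF sets_mu])
      (simp add: mu_integrand_def[abs_def] diff_op_def V_log_def)
  have meas_nu: "(\<lambda>z. \<Delta>\<^bsub>z\<^esub> V_log x) \<in> borel_measurable \<nu>" for x
    by (rule borel_measurable_half_line[OF sets_nu]) (simp add: diff_op_def V_log_def)
  have bound_mu: "\<bar>mu_integrand V_log x z\<bar> \<le> w\<mu> z" if "x \<ge> 0" "z > 0" for x z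
    unfolding w\<mu>_def by (rule mu_integrand_V_log_bound[OF that])
  have bound_nu: "0 \<le> \<Delta>\<^bsub>z\<^esub> V_log x" "\<Delta>\<^bsub>z\<^esub> V_log x \<le> w\<nu> z" if "x \<ge> 0" "z > 0" for x z
    unfolding w\<nu>_def by (rule diff_op_V_log_bounds[OF that])+
  have int_mu: "integrable \<mu> (mu_integrand V_log x)" if "x \<ge> 0" for x
  proof (rule Bochner_Integration.integrable_bound[OF int_w(1) meas_mu], rule AE_I2)
    fix z assume "z \<in> space \<mu>"
    then have "\<bar>mu_integrand V_log x z\<bar> \<le> w\<mu> z"
      using bound_mu that by (simp add: space_mu)
    then show "norm (mu_integrand V_log x z) \<le> norm (w\<mu> z)" by simp
  qed
  have int_nu: "integrable \<nu> (\<lambda>z. \<Delta>\<^bsub>z\<^esub> V_log x)" if "x \<ge> 0" for x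
  proof (rule Bochner_Integration.integrable_bound[OF int_w(2) meas_nu], rule AE_I2)
    fix z assume "z \<in> space \<nu>"
    then have "0 \<le> \<Delta>\<^bsub>z\<^esub> V_log x" "\<Delta>\<^bsub>z\<^esub> V_log x \<le> w\<nu> z"
      using bound_nu that by (simp_all add: space_nu)
    then show "norm (\<Delta>\<^bsub>z\<^esub> V_log x) \<le> norm (w\<nu> z)" by simp
  qed

  have cont_jump: "continuous_on {0..} (\<lambda>x. \<Delta>\<^bsub>z\<^esub> V_log x)" if "z > 0" for z
    unfolding diff_op_def V_log_def using that by (intro continuous_intros) auto
  have cont_deriv: "continuous_on {0..} (deriv_Rp V_log)"
  proof (rule continuous_on_eq)
    show "continuous_on {0..} (\<lambda>x::real. 1 / (1 + x))"
      by (intro continuous_intros) auto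
  qed (simp add: deriv_Rp_V_log)
  have "continuous_on {0..} (\<lambda>x. LINT z|\<mu>. mu_integrand V_log x z)"
  proof (rule continuous_on_integral_dominated[OF meas_mu _ _ int_w(1)])
    show "continuous_on {0..} (\<lambda>x. mu_integrand V_log x z)" if "z \<in> space \<mu>" for z
      using that unfolding mu_integrand_def space_mu
      by (intro continuous_intros cont_jump cont_deriv) auto
  qed (use bound_mu space_mu in auto)
  moreover have "continuous_on {0..} (\<lambda>x. LINT z|\<nu>. \<Delta>\<^bsub>z\<^esub> V_log x)"
  proof (rule continuous_on_integral_dominated[OF meas_nu _ _ int_w(2)])
    show "continuous_on {0..} (\<lambda>x. \<Delta>\<^bsub>z\<^esub> V_log x)" if "z \<in> space \<nu>" for z
      using that cont_jump by (simp add: space_nu)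
  qed (use bound_nu space_nu in auto)
  ultimately have dom: "V_log \<in> dom_L \<mu> \<nu>"
    unfolding dom_L_def using V_log_in_C2_Rp int_mu int_nu by blast

  define M where "M x = (LINT z:{1<..}|\<mu>. ln (1 + z / (1 + x)))" for x
  define m where "m = (LINT z|\<mu>. indicator {1<..} z * ln (1 + z))"
  have M_eq: "M x = (LINT z|\<mu>. indicator {1<..} z * ln (1 + z / (1 + x)))" for x
    by (simp add: M_def set_lebesgue_integral_def)
  have int_M: "integrable \<mu> (\<lambda>z. indicator {1<..} z * ln (1 + z / (1 + x)))" if "x \<ge> 0" for x
  proof (rule Bochner_Integration.integrable_bound[OF log_mu], goal_cases)
    case 1
    show ?case by (rule borel_measurable_half_line[OF sets_mu]) simp
  next
    case 2
    show ?case
      using ln_jump_nonneg[OF that] ln_jump_le[OF that]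
      by (intro AE_I2) (auto simp: space_mu indicator_def)
  qed
  have M_bounds: "0 \<le> M x" "M x \<le> m" if "x \<ge> 0" for x
  proof -
    show "0 \<le> M x"
      unfolding M_eq using ln_jump_nonneg[OF that]
      by (intro Bochner_Integration.integral_nonneg) (simp add: space_mu)
    show "M x \<le> m"
      unfolding M_eq m_def
      by (rule integral_mono[OF int_M[OF that] log_mu])
        (use ln_jump_le[OF that] in \<open>simp add: space_mu indicator_def\<close>)
  qed
  define k where "k = (LINT z|\<mu>. min 1 (z\<^sup>2))"
  define n where "n = (LINT z|\<nu>. w\<nu> z)"
  \<comment> \<open>The compensator lives on \<open>z \<le> 1\<close> only, so removing \<open>M x\<close> leaves exactly the Taylor remainders.\<close>
  have small: "\<bar>(LINT z|\<mu>. mu_integrand V_log x z) - M x\<bar> \<le> k / (1 + x)\<^sup>2" if "x \<ge> 0" for x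
  proof -
    have "\<bar>(LINT z|\<mu>. mu_integrand V_log x z) - M x\<bar>
        = \<bar>LINT z|\<mu>. mu_integrand V_log x z - indicator {1<..} z * ln (1 + z / (1 + x))\<bar>"
      unfolding M_eq
      by (subst Bochner_Integration.integral_diff[OF int_mu[OF that] int_M[OF that]]) simp
    also have "\<dots> \<le> (LINT z|\<mu>. \<bar>mu_integrand V_log x z - indicator {1<..} z * ln (1 + z / (1 + x))\<bar>)"
      by (rule integral_abs_bound)
    also have "\<dots> \<le> (LINT z|\<mu>. min 1 (z\<^sup>2) / (1 + x)\<^sup>2)"
      using mu_integrand_V_log_small_jumps[OF that] int_mu[OF that] int_M[OF that] small_mu
      by (intro integral_mono) (auto simp: space_mu)
    also have "\<dots> = k / (1 + x)\<^sup>2"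
      by (simp add: k_def)
    finally show ?thesis .
  qed
  have nu_bounds: "0 \<le> (LINT z|\<nu>. \<Delta>\<^bsub>z\<^esub> V_log x)" "(LINT z|\<nu>. \<Delta>\<^bsub>z\<^esub> V_log x) \<le> n"
    if "x \<ge> 0" for x
  proof -
    show "0 \<le> (LINT z|\<nu>. \<Delta>\<^bsub>z\<^esub> V_log x)"
      using bound_nu[OF that] by (intro Bochner_Integration.integral_nonneg) (simp add: space_nu)
    show "(LINT z|\<nu>. \<Delta>\<^bsub>z\<^esub> V_log x) \<le> n"
      unfolding n_def
      by (rule integral_mono[OF int_nu[OF that] int_w(2)])
        (use bound_nu[OF that] in \<open>simp add: space_nu\<close>)
  qed
  have "k \<ge> 0"
    unfolding k_def by (intro Bochner_Integration.integral_nonneg) simp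
  have approx: "\<bar>gen_L b c \<beta> g \<mu> \<nu> V_log x - (x * M x - g x / (1 + x))\<bar>
      \<le> c + k + (\<bar>\<beta>\<bar> + \<bar>b\<bar>) + n" if x: "x \<ge> 0" for x
  proof -
    have "x \<le> (1 + x)\<^sup>2"
      using x by (simp add: power2_eq_square algebra_simps)
    then have q: "0 \<le> x / (1 + x)\<^sup>2" "x / (1 + x)\<^sup>2 \<le> 1"
      using x by simp_all
    define I where "I = (LINT z|\<mu>. mu_integrand V_log x z)"
    define J where "J = (LINT z|\<nu>. \<Delta>\<^bsub>z\<^esub> V_log x)"
    have "gen_L b c \<beta> g \<mu> \<nu> V_log x - (x * M x - g x / (1 + x))
        = - (c * (x / (1 + x)\<^sup>2)) + x * (I - M x) + (\<beta> - b * x) / (1 + x) + J"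
      unfolding gen_L_def I_def J_def
      by (simp add: deriv_Rp_V_log deriv2_Rp_V_log x algebra_simps diff_divide_distrib)
    moreover have "0 \<le> c * (x / (1 + x)\<^sup>2)" "c * (x / (1 + x)\<^sup>2) \<le> c"
      using mult_nonneg_nonneg[OF assms(1) q(1)] mult_left_mono[OF q(2) assms(1)] by simp_all
    moreover have "\<bar>x * (I - M x)\<bar> \<le> k"
    proof -
      have "\<bar>x * (I - M x)\<bar> \<le> x * (k / (1 + x)\<^sup>2)"
        using mult_left_mono[OF small[OF x] x] x by (simp add: abs_mult I_def)
      also have "\<dots> = x / (1 + x)\<^sup>2 * k" by simp
      also have "\<dots> \<le> 1 * k"
        using q \<open>k \<ge> 0\<close> by (intro mult_right_mono) auto
      finally show ?thesis by simp
    qed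
    moreover have "\<bar>(\<beta> - b * x) / (1 + x)\<bar> \<le> \<bar>\<beta>\<bar> + \<bar>b\<bar>"
    proof -
      have "\<bar>\<beta> - b * x\<bar> \<le> \<bar>\<beta>\<bar> + \<bar>b\<bar> * x"
        using abs_triangle_ineq4[of \<beta> "b * x"] x by (simp add: abs_mult)
      also have "\<dots> \<le> (\<bar>\<beta>\<bar> + \<bar>b\<bar>) * (1 + x)"
        using x by (simp add: algebra_simps)
      finally show ?thesis
        using x by (simp add: abs_divide pos_divide_le_eq)
    qed
    moreover have "0 \<le> J" "J \<le> n"
      using nu_bounds[OF x] by (simp_all add: J_def)
    ultimately show ?thesis by linarith
  qed
  have "0 \<le> g x" if "x \<ge> 0" for x
    using mono_onD[OF assms(7), of 0 x] that assms(9) by simp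
  from log_drift_iff_Liminf[OF this M_bounds approx] dom show ?thesis
    unfolding M_def by blast
qed

end
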